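(* Let $\alpha\in(\frac13,\frac12]$, $T>0$, let $V,W,U$ be Banach spaces, let $\mathbf X=(1,X,\mathbb X)\in\mathcal D^\alpha(\Delta_T,V)$, and let $\mathbf Y=(Y,Y')\in\mathcal C^\alpha_{\mathbf X}([0,T],\mathcal L(W,U))$ and $\mathbf Z=(Z,Z')\in\mathcal C^\alpha_{\mathbf X}([0,T],W)$. Then $$\Big(\int_0^{\bullet}Y_r\,d\mathbf Z_r,\;YZ'\Big)\in\mathcal C^\alpha_{\mathbf X}([0,T],U),$$ where $(YZ')_t:=Y_tZ'_t\in\mathcal L(V,U)$ is the composition of $Z'_t\in\mathcal L(V,W)$ with $Y_t\in\mathcal L(W,U)$.
   Context: All Banach spaces are real; tensor products of Banach spaces carry a fixed admissible cross norm and are completed (for definiteness one may take the projective tensor norm throughout). $\mathcal L(A,B)$ is the space of bounded linear maps. For a path $X$, $X_{s,t}:=X_t-X_s$. $\Delta_T:=\{(s,t):0\le s\le t\le T\}$. Rough path: for $\alpha\in(\frac13,\frac12]$, $\mathbf X=(1,X,\mathbb X):\Delta_T\to\mathbb R\oplus V\oplus V^{\otimes2}$ belongs to $\mathcal D^\alpha(\Delta_T,V)$ if Chen's relation holds, i.e. $X_{s,t}=X_{s,u}+X_{u,t}$ and $\mathbb X_{s,t}=\mathbb X_{s,u}+\mathbb X_{u,t}+X_{s,u}\otimes X_{u,t}$ for $s\le u\le t$, and $\sup_{s\ne t}\frac{|X_{s,t}|}{|t-s|^\alpha}<\infty$, $\sup_{s\neq t}\frac{|\mathbb X_{s,t}|}{|t-s|^{2\alpha}}<\infty$.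 Controlled rough path: for a Banach space $E$, $\mathcal C^\alpha_{\mathbf X}([0,T],E)$ is the set of $\mathbf Y=(Y,Y'):[0,T]\to E\times\mathcal L(V,E)$ such that, with $R^{0,\mathbf Y}_{s,t}:=Y_{s,t}-Y'_sX_{s,t}$ and $R^{1,\mathbf Y}_{s,t}:=Y'_t-Y'_s$, one has $\sup_{s\ne t}\frac{|R^{0,\mathbf Y}_{s,t}|}{|t-s|^{2\alpha}}<\infty$ and $\sup_{s\ne t}\frac{|R^{1,\mathbf Y}_{s,t}|}{|t-s|^{\alpha}}<\infty$. Rough integral: $\int_s^tY_r\,d\mathbf Z_r:=\lim_{|\pi|\to0}\sum_{[u,v]\in\pi}\big(Y_uZ_{u,v}+Y'_uZ'_u\mathbb X_{u,v}\big)\in U$, over partitions $\pi$ of $[s,t]$ (this limit is known to exist), where $Y'_uZ'_u$ acts on $V\otimes V$ as the linear extension of $x_1\otimes x_2\mapsto[Y'_u(x_1)](Z'_u(x_2))$. *)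

theory Defs
  imports "HOL-Analysis.Analysis"
begin

(* The completed projective tensor product of 'a and 'b, up to isometric isomorphism: the Banach
   space 'c with the map tens, (x, y) \<mapsto> x \<otimes> y.  The first two conjuncts say that the span of the
   elementary tensors is the algebraic tensor product (scalar-valued bilinear forms suffice: they
   already force the canonical map from the algebraic tensor product onto the span to be
   injective).  In the norm formula the scalars of a linear combination of elementary tensors are
   absorbed into x. *)
definition projective_tensor ::
  "('a::banach \<Rightarrow> 'b::banach \<Rightarrow> 'c::banach) \<Rightarrow> bool" where
  "projective_tensor tens \<longleftrightarrow>
     bilinear tens \<and>
     (\<forall>B :: 'a \<Rightarrow> 'b \<Rightarrow> real. bilinear B \<longrightarrow>
        (\<exists>f :: 'c \<Rightarrow> real. linear f \<and> (\<forall>x y. f (tens x y) = B x y))) \<and>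
     (\<forall>z \<in> span {tens x y | x y. True}.
        norm z = Inf {(\<Sum>i<n. norm (x i) * norm (y i)) | (n::nat) (x::nat \<Rightarrow> 'a) (y::nat \<Rightarrow> 'b).
                        z = (\<Sum>i<n. tens (x i) (y i))}) \<and>
     closure (span {tens x y | x y. True}) = UNIV"

definition holder_bounded :: "real \<Rightarrow> real \<Rightarrow> (real \<Rightarrow> real \<Rightarrow> 'e::real_normed_vector) \<Rightarrow> bool" where
  "holder_bounded \<beta> T F \<longleftrightarrow>
     bdd_above {norm (F s t) / (t - s) powr \<beta> | s t. 0 \<le> s \<and> s < t \<and> t \<le> T}"

(* The constant scalar component 1 of (1, X, XX) is left implicit.  X and XX are functions of
   (s, t), of which only the values with 0 \<le> s \<le> t \<le> T matter. *)
definition rough_path ::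
  "('v::banach \<Rightarrow> 'v \<Rightarrow> 't::banach) \<Rightarrow> real \<Rightarrow> real \<Rightarrow>
   (real \<Rightarrow> real \<Rightarrow> 'v) \<Rightarrow> (real \<Rightarrow> real \<Rightarrow> 't) \<Rightarrow> bool" where
  "rough_path tens \<alpha> T X XX \<longleftrightarrow>
     (\<forall>s u t. 0 \<le> s \<and> s \<le> u \<and> u \<le> t \<and> t \<le> T \<longrightarrow>
        X s t = X s u + X u t \<and>
        XX s t = XX s u + XX u t + tens (X s u) (X u t)) \<and>
     holder_bounded \<alpha> T X \<and>
     holder_bounded (2 * \<alpha>) T XX"

definition controlled_paths ::
  "real \<Rightarrow> real \<Rightarrow> (real \<Rightarrow> real \<Rightarrow> 'v::banach) \<Rightarrow>
   ((real \<Rightarrow> 'e::banach) \<times> (real \<Rightarrow> 'v \<Rightarrow>\<^sub>L 'e)) set" where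
  "controlled_paths \<alpha> T X =
     {(Y, Y'). holder_bounded (2 * \<alpha>) T (\<lambda>s t. Y t - Y s - blinfun_apply (Y' s) (X s t)) \<and>
               holder_bounded \<alpha> T (\<lambda>s t. Y' t - Y' s)}"

definition tensor_extension ::
  "('v::banach \<Rightarrow> 'v \<Rightarrow> 't::banach) \<Rightarrow> ('v \<Rightarrow>\<^sub>L ('w::banach \<Rightarrow>\<^sub>L 'u::banach)) \<Rightarrow> ('v \<Rightarrow>\<^sub>L 'w) \<Rightarrow>
   ('t \<Rightarrow>\<^sub>L 'u)" where
  "tensor_extension tens A B =
     (THE L. \<forall>x1 x2. blinfun_apply L (tens x1 x2)
                       = blinfun_apply (blinfun_apply A x1) (blinfun_apply B x2))"

(* A partition of [s, t] is the strictly increasing list of its points, including s and t. *)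
definition partition_of :: "real \<Rightarrow> real \<Rightarrow> real list \<Rightarrow> bool" where
  "partition_of s t p \<longleftrightarrow> p \<noteq> [] \<and> sorted_wrt (<) p \<and> hd p = s \<and> last p = t"

definition mesh_to_zero :: "real \<Rightarrow> real \<Rightarrow> real list filter" where
  "mesh_to_zero s t =
     (INF \<delta>\<in>{0<..}. principal {p. partition_of s t p \<and>
        (\<forall>i. Suc i < length p \<longrightarrow> p ! Suc i - p ! i < \<delta>)})"

definition rough_integral ::
  "('v::banach \<Rightarrow> 'v \<Rightarrow> 't::banach) \<Rightarrow> (real \<Rightarrow> real \<Rightarrow> 't) \<Rightarrow>
   (real \<Rightarrow> ('w::banach \<Rightarrow>\<^sub>L 'u::banach)) \<times> (real \<Rightarrow> 'v \<Rightarrow>\<^sub>L ('w \<Rightarrow>\<^sub>L 'u)) \<Rightarrow>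
   (real \<Rightarrow> 'w) \<times> (real \<Rightarrow> 'v \<Rightarrow>\<^sub>L 'w) \<Rightarrow> real \<Rightarrow> real \<Rightarrow> 'u" where
  "rough_integral tens XX = (\<lambda>(Y, Y') (Z, Z') s t.
     Lim (mesh_to_zero s t) (\<lambda>p. \<Sum>i<length p - 1.
       (let u = p ! i; v = p ! Suc i in
          blinfun_apply (Y u) (Z v - Z u)
          + blinfun_apply (tensor_extension tens (Y' u) (Z' u)) (XX u v))))"

end

(* The Riemann sums of the germ Xi(u,v) = Y_u Z_{u,v} + (Y'_u Z'_u) XX_{u,v} converge by the sewing
   lemma: Chen's relation gives
     Xi(s,t) - Xi(s,u) - Xi(u,t) = - R^{0,Y}_{s,u} Z_{u,t} - (Y'_s X_{s,u}) R^{0,Z}_{u,t}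
        - (Y'_s X_{s,u}) ((Z'_u - Z'_s) X_{u,t}) - (Y'_u Z'_u - Y'_s Z'_s) XX_{u,t},
   which is of order |t-s|^(3 alpha) with 3 alpha > 1.  The integral is additive and differs from Xi
   by O(|t-s|^(3 alpha)), and Xi(s,t) = Y_s Z'_s X_{s,t} + Y_s R^{0,Z}_{s,t} + (Y'_s Z'_s) XX_{s,t},
   where the last two terms are O(|t-s|^(2 alpha)).

   The operators Y'_u Z'_u on the tensor product exist because the span of the pairs
   (x \<otimes> y, beta(x, y)) is the graph of a bounded operator on a dense subspace: it is single-valued
   since linear functionals on the target turn beta into scalar bilinear forms, and the projective
   norm is by definition large enough for the bound. *)
theory Submission
  imports Defs
begin

section \<open>Bounded bilinear maps on the projective tensor product\<close>

text \<open>Makes the set of representations, over which the projective norm is an infimum,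
  nonempty. Scalars are absorbed into the first factor.\<close>

lemma projective_tensor_span_sum:
  assumes "projective_tensor tens" and "z \<in> span {tens x y | x y. True}"
  shows "\<exists>(n::nat) x y. z = (\<Sum>i<n. tens (x i) (y i))"
  using assms(2)
proof (induction rule: span_induct_alt)
  case base
  have "0 = (\<Sum>i<0::nat. tens (undefined i) (undefined i))" by simp
  then show ?case by blast
next
  case (step c b z)
  from step.hyps obtain a b' where b: "b = tens a b'" by blast
  from step.IH obtain n :: nat and x y where z: "z = (\<Sum>i<n. tens (x i) (y i))" by blast
  have "linear (\<lambda>x. tens x b')"
    using assms(1) by (simp add: projective_tensor_def bilinear_def)
  from linear_scale[OF this, of c a] have "c *\<^sub>R b = tens (c *\<^sub>R a) b'" by (simp add: b)
  then have "c *\<^sub>R b + z = (\<Sum>i<Suc n. tens ((x(n := c *\<^sub>R a)) i) ((y(n := b')) i))"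
    by (simp add: z)
  then show ?case by blast
qed

text \<open>Every representation of z as a sum of elementary tensors determines the same w, so w is
  bounded by K times each representing sum and hence by K times the infimum. Stating this for pairs
  in a span, before any operator exists, gives well-definedness too: z = 0 forces w = 0.\<close>

lemma projective_tensor_extension_bound:
  fixes tens :: "'a::banach \<Rightarrow> 'b::banach \<Rightarrow> 'c::banach" and \<beta> :: "'a \<Rightarrow> 'b \<Rightarrow> 'd::real_normed_vector"
  assumes tens: "projective_tensor tens" and \<beta>: "bilinear \<beta>"
    and K: "\<And>x y. norm (\<beta> x y) \<le> K * (norm x * norm y)" and "0 \<le> K"
    and zw: "(z, w) \<in> span {(tens x y, \<beta> x y) | x y. True}" (is "_ \<in> span ?G")
  shows "norm w \<le> K * norm z"
proof -
  let ?S = "span {tens x y | x y. True}"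
  have single_valued: "v = 0" if v: "(0, v) \<in> span ?G" for v
  proof (rule ccontr)
    assume "v \<noteq> 0"
    \<comment> \<open>The functional comes from extending {v} to a Hamel basis and may be unbounded;
      the universal property in \<open>projective_tensor\<close> covers all scalar bilinear
      forms.\<close>
    then have "independent {v}" by simp
    then obtain \<phi> :: "'d \<Rightarrow> real" where \<phi>: "linear \<phi>" "\<phi> v = 1"
      using linear_independent_extend[of "{v}" "\<lambda>_. 1"] by auto
    have "bilinear (\<lambda>x y. \<phi> (\<beta> x y))"
      unfolding bilinear_def
    proof (intro conjI allI)
      show "linear (\<lambda>y. \<phi> (\<beta> x y))" for x
        using \<beta> linear_compose[of "\<beta> x" \<phi>] \<phi>(1) by (simp add: bilinear_def o_def)
      show "linear (\<lambda>x. \<phi> (\<beta> x y))" for y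
        using \<beta> linear_compose[of "\<lambda>x. \<beta> x y" \<phi>] \<phi>(1) by (simp add: bilinear_def o_def)
    qed
    then obtain f :: "'c \<Rightarrow> real" where f: "linear f" "\<And>x y. f (tens x y) = \<phi> (\<beta> x y)"
      using tens unfolding projective_tensor_def by blast
    \<comment> \<open>This functional vanishes on the generating pairs, hence at (0, v), where its
      value is -1.\<close>
    have "linear (\<lambda>p. f (fst p) - \<phi> (snd p))"
      using linear_compose_sub[OF linear_compose[OF linear_fst f(1)] linear_compose[OF linear_snd \<phi>(1)]]
      by (simp add: o_def)
    then have "(\<lambda>p. f (fst p) - \<phi> (snd p)) (0, v) = 0"
      by (rule linear_eq_0_on_span[OF _ _ v]) (auto simp: f)
    then show False using f(1) \<phi>(2) by (simp add: linear_0)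
  qed
  have "fst ` span ?G = span (fst ` ?G)"
    by (rule linear_span_image[symmetric, OF linear_fst])
  also have "fst ` ?G = {tens x y | x y. True}" by force
  finally have z: "z \<in> ?S" using zw by force
  let ?N = "{(\<Sum>i<n. norm (x i) * norm (y i)) | (n::nat) x y. z = (\<Sum>i<n. tens (x i) (y i))}"
  have N: "norm z = Inf ?N" using tens z unfolding projective_tensor_def by blast
  have "?N \<noteq> {}" using projective_tensor_span_sum[OF tens z] by blast
  have le: "norm w \<le> K * r" if r: "r \<in> ?N" for r
  proof -
    obtain n :: nat and x y where r_sum: "r = (\<Sum>i<n. norm (x i) * norm (y i))"
      and zs: "z = (\<Sum>i<n. tens (x i) (y i))" using r by blast
    have "(\<Sum>i<n. (tens (x i) (y i), \<beta> (x i) (y i))) \<in> span ?G"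
      by (intro span_sum span_base) blast
    then have "(z, \<Sum>i<n. \<beta> (x i) (y i)) \<in> span ?G" by (simp add: zs sum_prod)
    \<comment> \<open>Two pairs of the span share the first component z, so their difference falls
      under \<open>single_valued\<close>.\<close>
    from span_diff[OF zw this] have "w - (\<Sum>i<n. \<beta> (x i) (y i)) = 0"
      by (intro single_valued) (simp only: diff_Pair diff_self)
    then have "w = (\<Sum>i<n. \<beta> (x i) (y i))" by simp
    also have "norm \<dots> \<le> (\<Sum>i<n. K * (norm (x i) * norm (y i)))"
      by (intro sum_norm_le K)
    finally show ?thesis by (simp add: r_sum sum_distrib_left)
  qed
  show ?thesis
  \<comment> \<open>Passing to the infimum divides by K; for K = 0 any single representation already
    gives w = 0.\<close>
  proof (cases "K = 0")
    case True
    with \<open>?N \<noteq> {}\<close> le show ?thesis by fastforce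
  next
    case False
    with \<open>0 \<le> K\<close> have "0 < K" by simp
    then have "norm w / K \<le> Inf ?N"
      using le by (intro cInf_greatest[OF \<open>?N \<noteq> {}\<close>]) (simp add: divide_le_eq mult.commute)
    then show ?thesis using \<open>0 < K\<close> N by (simp add: divide_le_eq mult.commute)
  qed
qed

text \<open>A bounded linear map on S is Lipschitz, so it extends uniformly continuously to the
  closure; additivity, homogeneity and the bound survive limits of sequences from S. The values of f
  outside S are arbitrary, which is why linearity is assumed on S only.\<close>

lemma bounded_linear_extension_dense:
  fixes f :: "'a::real_normed_vector \<Rightarrow> 'b::banach"
  assumes S: "subspace S" "closure S = UNIV"
    and add: "\<And>x y. x \<in> S \<Longrightarrow> y \<in> S \<Longrightarrow> f (x + y) = f x + f y"
    and scale: "\<And>c x. x \<in> S \<Longrightarrow> f (c *\<^sub>R x) = c *\<^sub>R f x"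
    and bound: "\<And>x. x \<in> S \<Longrightarrow> norm (f x) \<le> K * norm x" and "0 \<le> K"
  obtains L where "\<And>x. x \<in> S \<Longrightarrow> blinfun_apply L x = f x" and "norm L \<le> K"
proof -
  have diff: "f x - f y = f (x - y)" if "x \<in> S" "y \<in> S" for x y
    using add[of "x - y" y] that S(1) by (simp add: subspace_diff)
  have "K-lipschitz_on S f"
    using bound diff S(1) \<open>0 \<le> K\<close> by (auto intro!: lipschitz_onI simp: dist_norm subspace_diff)
  then have "uniformly_continuous_on S f" by (rule lipschitz_on_uniformly_continuous)
  from uniformly_continuous_on_extension_on_closure[OF this]
  obtain g where g: "uniformly_continuous_on UNIV g" "\<And>x. x \<in> S \<Longrightarrow> f x = g x"
    unfolding S(2) by metis
  have cont: "(\<lambda>n. g (h n)) \<longlonglongrightarrow> g x" if "h \<longlonglongrightarrow> x" for h x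
    using uniformly_continuous_imp_continuous[OF g(1)] that
    by (simp add: continuous_on_sequentially o_def)
  have approx: "\<exists>h. (\<forall>n. h n \<in> S) \<and> h \<longlonglongrightarrow> x" for x
    using S(2) closure_sequential[of x S] by auto
  have "bounded_linear g"
  proof (rule bounded_linear_intro)
    fix x y
    obtain h k where hk: "\<And>n. h n \<in> S" "h \<longlonglongrightarrow> x" "\<And>n. k n \<in> S" "k \<longlonglongrightarrow> y"
      using approx by meson
    have "(\<lambda>n. g (h n + k n)) \<longlonglongrightarrow> g (x + y)"
      using cont[OF tendsto_add[OF hk(2,4)]] by (simp add: o_def)
    moreover have "(\<lambda>n. g (h n + k n)) = (\<lambda>n. g (h n) + g (k n))"
      using hk S(1) add by (auto simp: g(2)[symmetric] subspace_add)
    moreover have "(\<lambda>n. g (h n) + g (k n)) \<longlonglongrightarrow> g x + g y"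
      using tendsto_add[OF cont[OF hk(2)] cont[OF hk(4)]] by (simp add: o_def)
    ultimately show "g (x + y) = g x + g y" using LIMSEQ_unique by metis
  next
    fix c x
    obtain h where h: "\<And>n. h n \<in> S" "h \<longlonglongrightarrow> x" using approx by meson
    have "(\<lambda>n. g (c *\<^sub>R h n)) \<longlonglongrightarrow> g (c *\<^sub>R x)"
      using cont[OF tendsto_scaleR[OF tendsto_const h(2)]] by (simp add: o_def)
    moreover have "(\<lambda>n. g (c *\<^sub>R h n)) = (\<lambda>n. c *\<^sub>R g (h n))"
      using h S(1) scale by (auto simp: g(2)[symmetric] subspace_scale)
    moreover have "(\<lambda>n. c *\<^sub>R g (h n)) \<longlonglongrightarrow> c *\<^sub>R g x"
      using tendsto_scaleR[OF tendsto_const cont[OF h(2)]] by (simp add: o_def)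
    ultimately show "g (c *\<^sub>R x) = c *\<^sub>R g x" using LIMSEQ_unique by metis
  next
    fix x
    obtain h where h: "\<And>n. h n \<in> S" "h \<longlonglongrightarrow> x" using approx by meson
    have "(\<lambda>n. norm (g (h n))) \<longlonglongrightarrow> norm (g x)"
      using tendsto_norm[OF cont[OF h(2)]] by (simp add: o_def)
    moreover have "(\<lambda>n. norm (h n) * K) \<longlonglongrightarrow> norm x * K"
      by (intro tendsto_intros h)
    ultimately show "norm (g x) \<le> norm x * K"
      by (rule LIMSEQ_le) (use h bound in \<open>auto simp: g(2)[symmetric] mult.commute\<close>)
  qed
  show ?thesis
  proof
    show "blinfun_apply (Blinfun g) x = f x" if "x \<in> S" for x
      using \<open>bounded_linear g\<close> g(2)[OF that] by (simp add: bounded_linear_Blinfun_apply)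
    have "norm (g x) \<le> K * norm x" for x
    proof -
      obtain h where h: "\<And>n. h n \<in> S" "h \<longlonglongrightarrow> x" using approx by meson
      have "(\<lambda>n. norm (g (h n))) \<longlonglongrightarrow> norm (g x)"
        using tendsto_norm[OF cont[OF h(2)]] by (simp add: o_def)
      moreover have "(\<lambda>n. K * norm (h n)) \<longlonglongrightarrow> K * norm x"
        by (intro tendsto_intros h)
      ultimately show ?thesis
        by (rule LIMSEQ_le) (use h bound in \<open>auto simp: g(2)[symmetric]\<close>)
    qed
    then show "norm (Blinfun g) \<le> K"
      using \<open>0 \<le> K\<close> \<open>bounded_linear g\<close>
      by (intro norm_blinfun_bound) (simp_all add: bounded_linear_Blinfun_apply)
  qed
qed

text \<open>The set where two bounded operators agree is closed and contains a dense span. This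
  settles uniqueness for the definite description in \<open>tensor_extension\<close>.\<close>

lemma projective_tensor_extension_unique:
  fixes tens :: "'a::banach \<Rightarrow> 'b::banach \<Rightarrow> 'c::banach" and L M :: "'c \<Rightarrow>\<^sub>L 'd::real_normed_vector"
  assumes "projective_tensor tens" and eq: "\<And>x y. L (tens x y) = M (tens x y)"
  shows "L = M"
proof (rule blinfun_eqI)
  fix z
  let ?S = "span {tens x y | x y. True}"
  have "blinfun_apply L z = blinfun_apply M z" if "z \<in> ?S" for z
    by (rule linear_eq_on_span[OF _ _ _ that])
      (auto simp: eq bounded_linear.linear blinfun.bounded_linear_right)
  moreover have "closed {z. blinfun_apply L z = blinfun_apply M z}"
    by (intro closed_Collect_eq continuous_intros)
  ultimately have "closure ?S \<subseteq> {z. blinfun_apply L z = blinfun_apply M z}"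
    by (intro closure_minimal) auto
  then show "blinfun_apply L z = blinfun_apply M z"
    using assms(1) by (auto simp: projective_tensor_def)
qed

lemma projective_tensor_extension:
  fixes tens :: "'a::banach \<Rightarrow> 'b::banach \<Rightarrow> 'c::banach" and \<beta> :: "'a \<Rightarrow> 'b \<Rightarrow> 'd::banach"
  assumes tens: "projective_tensor tens" and \<beta>: "bilinear \<beta>"
    and K: "\<And>x y. norm (\<beta> x y) \<le> K * (norm x * norm y)" and "0 \<le> K"
  obtains L where "\<And>x y. blinfun_apply L (tens x y) = \<beta> x y" and "norm L \<le> K"
proof -
  let ?G = "{(tens x y, \<beta> x y) | x y. True}"
  let ?S = "span {tens x y | x y. True}"
  note bound = projective_tensor_extension_bound[OF tens \<beta> K \<open>0 \<le> K\<close>]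
  \<comment> \<open>The bound applied to the difference of the two pairs, whose first component is
    0.\<close>
  have unique: "w = w'" if "(z, w) \<in> span ?G" "(z, w') \<in> span ?G" for z w w'
    using bound[OF span_diff[OF that, unfolded diff_Pair]] by simp
  define f where "f z = (SOME w. (z, w) \<in> span ?G)" for z
  have "fst ` span ?G = span (fst ` ?G)"
    by (rule linear_span_image[symmetric, OF linear_fst])
  also have "fst ` ?G = {tens x y | x y. True}" by force
  finally have S: "?S = fst ` span ?G" ..
  have f_eq: "f z = w" if "(z, w) \<in> span ?G" for z w
    unfolding f_def using that unique by blast
  have f: "(z, f z) \<in> span ?G" if z: "z \<in> ?S" for z
  proof -
    obtain p where "p \<in> span ?G" "z = fst p" using z unfolding S by blast
    then have "(z, snd p) \<in> span ?G" by simp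
    from this f_eq[OF this] show ?thesis by (simp only:)
  qed
  have dense: "closure ?S = UNIV" using tens by (simp add: projective_tensor_def)
  obtain L where L: "\<And>z. z \<in> ?S \<Longrightarrow> blinfun_apply L z = f z" "norm L \<le> K"
  proof (rule bounded_linear_extension_dense[OF subspace_span dense _ _ _ \<open>0 \<le> K\<close>])
    show "f (x + y) = f x + f y" if "x \<in> ?S" "y \<in> ?S" for x y
      using span_add[OF f f, OF that] by (intro f_eq) simp
    show "f (c *\<^sub>R x) = c *\<^sub>R f x" if "x \<in> ?S" for c x
      using span_scale[OF f[OF that], of c] by (intro f_eq) simp
    show "norm (f x) \<le> K * norm x" if "x \<in> ?S" for x
      using bound f that by blast
  qed blast
  have "blinfun_apply L (tens x y) = \<beta> x y" for x y
  proof -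
    have "(tens x y, \<beta> x y) \<in> span ?G" by (rule span_base) blast
    moreover have "tens x y \<in> ?S" by (rule span_base) blast
    ultimately show ?thesis by (simp add: L f_eq)
  qed
  with L(2) that show thesis by blast
qed

text \<open>Shows that the definite description denotes an operator; afterwards it is handled only
  through these two facts and uniqueness.\<close>

lemma tensor_extension:
  fixes A :: "'v::banach \<Rightarrow>\<^sub>L ('w::banach \<Rightarrow>\<^sub>L 'u::banach)" and B :: "'v \<Rightarrow>\<^sub>L 'w"
  assumes tens: "projective_tensor tens"
  shows tensor_extension_apply: "tensor_extension tens A B (tens x y) = A x (B y)"
    and norm_tensor_extension: "norm (tensor_extension tens A B) \<le> norm A * norm B"
proof -
  have "bilinear (\<lambda>x y. A x (B y))"
    by (auto simp: bilinear_def blinfun.bilinear_simps intro!: linearI)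
  moreover have "norm (A x (B y)) \<le> norm A * norm B * (norm x * norm y)" for x y
  proof -
    have "norm (A x (B y)) \<le> norm (A x) * norm (B y)" by (rule norm_blinfun)
    also have "\<dots> \<le> (norm A * norm x) * (norm B * norm y)"
      by (intro mult_mono norm_blinfun) auto
    finally show ?thesis by (simp add: mult_ac)
  qed
  ultimately obtain L where L: "\<And>x y. blinfun_apply L (tens x y) = A x (B y)"
      "norm L \<le> norm A * norm B"
    using projective_tensor_extension[OF tens, of "\<lambda>x y. A x (B y)" "norm A * norm B"] by auto
  have "tensor_extension tens A B = L"
    unfolding tensor_extension_def
  proof (rule the_equality)
    show "M = L" if "\<forall>x1 x2. blinfun_apply M (tens x1 x2) = A x1 (B x2)" for M
      using that L(1) by (intro projective_tensor_extension_unique[OF tens]) auto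
  qed (use L in auto)
  with L show "tensor_extension tens A B (tens x y) = A x (B y)"
    "norm (tensor_extension tens A B) \<le> norm A * norm B" by auto
qed

text \<open>The product rule for differences; it yields the \<alpha>-Hoelder continuity of u
  \<mapsto> \<open>tensor_extension tens (Y' u) (Z' u)\<close>.\<close>

lemma tensor_extension_diff:
  assumes tens: "projective_tensor tens"
  shows "tensor_extension tens A B - tensor_extension tens C D
       = tensor_extension tens (A - C) B + tensor_extension tens C (B - D)"
  by (rule projective_tensor_extension_unique[OF tens])
    (simp add: blinfun.bilinear_simps tensor_extension_apply[OF tens])

section \<open>The sewing lemma\<close>

definition riemann_sum :: "(real \<Rightarrow> real \<Rightarrow> 'u::real_normed_vector) \<Rightarrow> real list \<Rightarrow> 'u" where
  "riemann_sum \<Xi> p = (\<Sum>i<length p - 1. \<Xi> (p ! i) (p ! Suc i))"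

definition mesh_below :: "real \<Rightarrow> real list \<Rightarrow> bool" where
  "mesh_below \<delta> p \<longleftrightarrow> (\<forall>i. Suc i < length p \<longrightarrow> p ! Suc i - p ! i < \<delta>)"

lemma riemann_sum_single [simp]: "riemann_sum \<Xi> [x] = 0"
  by (simp add: riemann_sum_def)

lemma riemann_sum_Cons_Cons [simp]:
  "riemann_sum \<Xi> (x # y # p) = \<Xi> x y + riemann_sum \<Xi> (y # p)"
  by (simp add: riemann_sum_def sum.lessThan_Suc_shift del: sum.lessThan_Suc)

text \<open>The cut point x ends the first list and starts the second, so no interval is lost. The
  mesh and the partition property are cut in the same shape below.\<close>

lemma riemann_sum_append:
  "riemann_sum \<Xi> (p @ x # q) = riemann_sum \<Xi> (p @ [x]) + riemann_sum \<Xi> (x # q)"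
proof (induction p)
  case (Cons y p)
  then show ?case by (cases p) simp_all
qed simp

lemma mesh_below_single [simp]: "mesh_below \<delta> [x]"
  by (simp add: mesh_below_def)

lemma mesh_below_Cons_Cons [simp]:
  "mesh_below \<delta> (x # y # p) \<longleftrightarrow> y - x < \<delta> \<and> mesh_below \<delta> (y # p)"
  unfolding mesh_below_def
  by (auto simp: less_Suc_eq_0_disj nth_Cons split: nat.splits)

lemma mesh_below_append:
  "mesh_below \<delta> (p @ x # q) \<longleftrightarrow> mesh_below \<delta> (p @ [x]) \<and> mesh_below \<delta> (x # q)"
proof (induction p)
  case (Cons y p)
  then show ?case by (cases p) simp_all
qed simp

lemma partition_of_Nil [simp]: "\<not> partition_of s t []"
  by (simp add: partition_of_def)

lemma partition_of_single [simp]: "partition_of s t [x] \<longleftrightarrow> x = s \<and> x = t"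
  by (auto simp: partition_of_def)

lemma partition_of_Cons_Cons [simp]:
  "partition_of s t (x # y # p) \<longleftrightarrow> x = s \<and> s < y \<and> partition_of y t (y # p)"
  by (auto simp: partition_of_def)

lemma partition_of_append:
  "partition_of s t (p @ x # q) \<longleftrightarrow> partition_of s x (p @ [x]) \<and> partition_of x t (x # q)"
proof (induction p arbitrary: s)
  case Nil
  then show ?case by (simp add: partition_of_def conj_ac)
next
  case IH: (Cons y p)
  show ?case
  proof (cases p)
    case Nil
    show ?thesis by (simp add: Nil)
  next
    case (Cons z p')
    with IH.IH show ?thesis by simp
  qed
qed

text \<open>A strictly increasing list is determined by its set of points; this form makes unions of
  partitions and membership arguments easy.\<close>

lemma partition_of_iff:
  "partition_of s t p \<longleftrightarrow>
     sorted_wrt (<) p \<and> s \<in> set p \<and> t \<in> set p \<and> (\<forall>x\<in>set p. s \<le> x \<and> x \<le> t)" (is "?L \<longleftrightarrow> ?R")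
proof
  assume L: ?L
  then have "s \<le> x" if "x \<in> set p" for x
    using that by (cases p) (auto simp: partition_of_def)
  moreover have "x \<le> t" if "x \<in> set p" for x
    using L that by (cases p rule: rev_cases) (auto simp: partition_of_def sorted_wrt_append)
  ultimately show ?R using L hd_in_set[of p] last_in_set[of p] by (auto simp: partition_of_def)
next
  assume R: ?R
  then have "hd p = s" by (cases p) fastforce+
  moreover have "last p = t"
    using R by (cases p rule: rev_cases) (fastforce simp: sorted_wrt_append)+
  ultimately show ?L using R by (auto simp: partition_of_def)
qed

lemma partition_of_le: "partition_of s t p \<Longrightarrow> s \<le> t"
  by (auto simp: partition_of_iff)

lemma partition_of_refl: "partition_of s s p \<Longrightarrow> p = [s]"
  by (cases p rule: remdups_adj.cases) (auto simp: partition_of_iff)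

lemma partition_of_common_refinement:
  assumes "partition_of s t p" and "partition_of s t q"
  shows "\<exists>r. partition_of s t r \<and> set p \<subseteq> set r \<and> set q \<subseteq> set r"
  using assms by (intro exI[of _ "sorted_list_of_set (set p \<union> set q)"]) (auto simp: partition_of_iff)

text \<open>Walk from s in steps of \<delta>/2 until less than \<delta> remains; n bounds the number
  of steps.\<close>

lemma partition_of_exists:
  assumes "s \<le> t" and "0 < \<delta>"
  shows "\<exists>p. partition_of s t p \<and> mesh_below \<delta> p"
proof -
  obtain n :: nat where n: "t - s < n * (\<delta> / 2)"
    using reals_Archimedean3[of "\<delta> / 2"] \<open>0 < \<delta>\<close> half_gt_zero by blast
  have "\<exists>p. partition_of s t p \<and> mesh_below \<delta> p" if "s \<le> t" "t - s < n * (\<delta> / 2)" for n :: nat and s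
    using that
  proof (induction n arbitrary: s)
    case (Suc n)
    show ?case
    proof (cases "t - s < \<delta>")
      case True
      \<comment> \<open>Points increase strictly, so the partition of a degenerate interval is a
        one-point list.\<close>
      with Suc.prems have "partition_of s t (if s = t then [s] else [s, t]) \<and>
          mesh_below \<delta> (if s = t then [s] else [s, t])" by auto
      then show ?thesis by blast
    next
      case False
      with \<open>0 < \<delta>\<close> Suc.prems have "s + \<delta> / 2 \<le> t" "t - (s + \<delta> / 2) < n * (\<delta> / 2)"
        by (auto simp: field_simps)
      from Suc.IH[OF this] obtain p where p: "partition_of (s + \<delta> / 2) t p" "mesh_below \<delta> p"
        by blast
      moreover from p have "hd p = s + \<delta> / 2" by (simp add: partition_of_def)
      ultimately have "partition_of s t (s # p) \<and> mesh_below \<delta> (s # p)"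
        using \<open>0 < \<delta>\<close>
        by (cases p) auto
      then show ?thesis by blast
    qed
  qed simp
  with n assms show ?thesis by blast
qed

text \<open>The principal filters are directed, the minimum of two mesh bounds serving both; so
  limits along \<open>mesh_to_zero\<close> take the usual epsilon-delta form.\<close>

lemma eventually_mesh_to_zero:
  "eventually P (mesh_to_zero s t) \<longleftrightarrow> (\<exists>\<delta>>0. \<forall>p. partition_of s t p \<and> mesh_below \<delta> p \<longrightarrow> P p)"
  unfolding mesh_to_zero_def mesh_below_def[symmetric]
proof (subst eventually_INF_base)
  show "\<exists>x\<in>{0<..}. principal {p. partition_of s t p \<and> mesh_below x p}
      \<le> inf (principal {p. partition_of s t p \<and> mesh_below a p}) (principal {p. partition_of s t p \<and> mesh_below b p})"
    if "a \<in> {0<..}" "b \<in> {0<..}" for a b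
    using that by (intro bexI[of _ "min a b"]) (auto simp: mesh_below_def)
qed (auto simp: eventually_principal)

lemma mesh_to_zero_neq_bot: "s \<le> t \<Longrightarrow> mesh_to_zero s t \<noteq> bot"
  unfolding trivial_limit_def eventually_mesh_to_zero using partition_of_exists by blast

section \<open>The sewing estimate and convergence of Riemann sums of an almost additive
  germ\<close>

context
  fixes \<Xi> :: "real \<Rightarrow> real \<Rightarrow> 'u::banach" and \<theta> C T :: real
  assumes \<theta>: "1 < \<theta>" and C: "0 \<le> C"
    and almost_additive: "\<And>s u t. 0 \<le> s \<Longrightarrow> s \<le> u \<Longrightarrow> u \<le> t \<Longrightarrow> t \<le> T \<Longrightarrow>
      norm (\<Xi> s t - \<Xi> s u - \<Xi> u t) \<le> C * (t - s) powr \<theta>"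
begin

definition sewing_const :: real where
  "sewing_const = 2 * C / (1 - 2 powr (1 - \<theta>))"

lemma sewing_const_nonneg: "0 \<le> sewing_const"
proof -
  have "2 powr (1 - \<theta>) < (2::real) powr 0" using \<theta> by (intro powr_less_mono) auto
  then show ?thesis using C by (simp add: sewing_const_def)
qed

text \<open>The constant solves \<open>2 K 2\<^sup>-\<^sup>\<theta> + 2 C = K\<close>, which is what cutting the partition at the
  midpoint of the interval yields.\<close>

lemma sewing_bound:
  assumes "0 \<le> s" and "t \<le> T" and "partition_of s t p"
  shows "norm (riemann_sum \<Xi> p - \<Xi> s t) \<le> sewing_const * (t - s) powr \<theta>"
  using assms
proof (induction p arbitrary: s t rule: length_induct)
  case (1 p)
  show ?case
  proof (cases "s = t")
    case True
    \<comment> \<open>Here p = [s] has Riemann sum 0, and almost additivity at (s, s, s) with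
      \<open>0 powr \<theta> = 0\<close> gives \<Xi> s s = 0.\<close>
    with 1 almost_additive[of s s s] show ?thesis by (auto dest!: partition_of_refl)
  next
    case False
    with 1 have st: "s < t" using partition_of_le by fastforce
    let ?m = "(s + t) / 2"
    \<comment> \<open>The last point x of a and the first point y of b straddle the midpoint. So
      [s, x] and [y, t] have at most half the length and shorter partitions, and [x, y] is a single
      interval of p.\<close>
    define a b where "a = takeWhile (\<lambda>x. x \<le> ?m) p" and "b = dropWhile (\<lambda>x. x \<le> ?m) p"
    have p: "p = a @ b" by (simp add: a_def b_def)
    have "a \<noteq> []"
      using 1(4) st by (cases p) (auto simp: a_def partition_of_def)
    then obtain a' x where a: "a = a' @ [x]" by (cases a rule: rev_cases) auto
    have x: "x \<le> ?m"
      using a set_takeWhileD[of x "\<lambda>x. x \<le> ?m" p] by (auto simp: a_def)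
    have "t \<in> set p" "\<not> t \<le> ?m" using 1(4) st by (auto simp: partition_of_iff)
    then have "b \<noteq> []" unfolding b_def dropWhile_eq_Nil_conv by blast
    then obtain y b' where b: "b = y # b'" by (cases b) auto
    have y: "?m < y"
      using b hd_dropWhile[of "\<lambda>x. x \<le> ?m" p] by (auto simp: b_def)
    have p_eq: "p = a' @ x # y # b'" by (simp add: p a b)
    have parts: "partition_of s x (a' @ [x])" "partition_of y t (y # b')" "x < y"
      using 1(4) by (auto simp: p_eq partition_of_append[of s t])
    have le: "s \<le> x" "y \<le> t" using parts(1,2) by (auto dest: partition_of_le)
    have half: "sewing_const * r powr \<theta> \<le> sewing_const * ((t - s) / 2) powr \<theta>"
      if "0 \<le> r" "r \<le> (t - s) / 2" for r
      using that \<theta> by (intro mult_left_mono powr_mono2 sewing_const_nonneg) auto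
    have "norm (riemann_sum \<Xi> (a' @ [x]) - \<Xi> s x) \<le> sewing_const * (x - s) powr \<theta>"
      using 1 parts le by (auto simp: p_eq)
    also have "\<dots> \<le> sewing_const * ((t - s) / 2) powr \<theta>"
      using le x by (intro half) (auto simp: field_simps)
    finally have left: "norm (riemann_sum \<Xi> (a' @ [x]) - \<Xi> s x) \<le> sewing_const * ((t - s) / 2) powr \<theta>" .
    have "norm (riemann_sum \<Xi> (y # b') - \<Xi> y t) \<le> sewing_const * (t - y) powr \<theta>"
      using 1 parts le by (auto simp: p_eq)
    also have "\<dots> \<le> sewing_const * ((t - s) / 2) powr \<theta>"
      using le y by (intro half) (auto simp: field_simps)
    finally have right: "norm (riemann_sum \<Xi> (y # b') - \<Xi> y t) \<le> sewing_const * ((t - s) / 2) powr \<theta>" .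
    have d1: "norm (\<Xi> s t - \<Xi> s x - \<Xi> x t) \<le> C * (t - s) powr \<theta>"
      using 1 le parts by (intro almost_additive) auto
    have "norm (\<Xi> x t - \<Xi> x y - \<Xi> y t) \<le> C * (t - x) powr \<theta>"
      using 1 le parts by (intro almost_additive) auto
    also have "\<dots> \<le> C * (t - s) powr \<theta>"
      using le parts \<theta> C by (intro mult_left_mono powr_mono2) auto
    finally have d2: "norm (\<Xi> x t - \<Xi> x y - \<Xi> y t) \<le> C * (t - s) powr \<theta>" .
    \<comment> \<open>Replacing \<Xi> s t by \<Xi> s x + \<Xi> x y + \<Xi> y t takes two insertions,
      first x and then y; their defects give the term 2 C.\<close>
    have "riemann_sum \<Xi> p - \<Xi> s t =
        (riemann_sum \<Xi> (a' @ [x]) - \<Xi> s x) + (riemann_sum \<Xi> (y # b') - \<Xi> y t)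
        - (\<Xi> s t - \<Xi> s x - \<Xi> x t) - (\<Xi> x t - \<Xi> x y - \<Xi> y t)"
      using riemann_sum_append[of \<Xi> a' x "y # b'"] by (simp add: p_eq)
    also have "norm \<dots> \<le> 2 * (sewing_const * ((t - s) / 2) powr \<theta>) + 2 * (C * (t - s) powr \<theta>)"
      using order.trans[OF norm_triangle_ineq4 add_mono[OF order.trans[OF norm_triangle_ineq4
            add_mono[OF norm_triangle_mono[OF left right] d1]] d2]]
      by simp
    also have "\<dots> = (sewing_const * 2 powr (1 - \<theta>) + 2 * C) * (t - s) powr \<theta>"
      using st by (simp add: powr_divide powr_diff field_simps)
    also have "sewing_const * 2 powr (1 - \<theta>) + 2 * C = sewing_const"
    proof -
      have "2 powr (1 - \<theta>) < (2::real) powr 0" using \<theta> by (intro powr_less_mono) auto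
      then have "sewing_const * (1 - 2 powr (1 - \<theta>)) = 2 * C" using \<theta> by (simp add: sewing_const_def)
      then show ?thesis by (simp add: algebra_simps)
    qed
    finally show ?thesis .
  qed
qed

text \<open>\<open>sewing_bound\<close> applies to the part of r inside each interval of p. As an
  interval of length h < \<delta> has h^\<theta> \<le> \<delta>^(\<theta>-1) h, the errors add up to
  a multiple of t - s.\<close>

lemma riemann_sum_refinement:
  assumes "0 \<le> s" and "t \<le> T" and "0 < \<delta>"
    and "partition_of s t p" and "mesh_below \<delta> p" and "partition_of s t r" and "set p \<subseteq> set r"
  shows "norm (riemann_sum \<Xi> r - riemann_sum \<Xi> p) \<le> sewing_const * \<delta> powr (\<theta> - 1) * (t - s)"
  using assms
\<comment> \<open>The rule supplies the cases [], [x] and x # y # p; strict increase gives x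
  \<noteq> y, which selects the hypothesis for y # p.\<close>
proof (induction p arbitrary: s r rule: remdups_adj.induct)
  case 1
  then show ?case by (simp add: partition_of_def)
next
  case (2 x)
  then have "s = t" "r = [s]" by (auto dest: partition_of_refl)
  then show ?case by simp
next
  case (3 x y p)
  then have x: "x = s" and "s < y" "y - s < \<delta>" and py: "partition_of y t (y # p)"
    and mesh: "mesh_below \<delta> (y # p)" by auto
  have "y \<in> set r" using 3 by auto
  then obtain r1 r2 where r: "r = r1 @ y # r2" by (meson split_list)
  have r1: "partition_of s y (r1 @ [y])" and r2: "partition_of y t (y # r2)"
    using 3 partition_of_append[of s t r1 y r2] by (auto simp: r)
  \<comment> \<open>The coarse points from y onwards cannot lie in r1, whose points are all below
    y.\<close>
  have "set (y # p) \<subseteq> set (y # r2)"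
  proof
    fix z assume z: "z \<in> set (y # p)"
    then have "y \<le> z" using py by (auto simp: partition_of_iff)
    moreover have "z \<in> set r" using z 3 by auto
    moreover have "z < y" if "z \<in> set r1" using r1 that by (auto simp: partition_of_iff sorted_wrt_append)
    ultimately show "z \<in> set (y # r2)" by (auto simp: r)
  qed
  then have IH: "norm (riemann_sum \<Xi> (y # r2) - riemann_sum \<Xi> (y # p))
      \<le> sewing_const * \<delta> powr (\<theta> - 1) * (t - y)"
    using 3 \<open>s < y\<close> py mesh r2 by (cases "y = x") auto
  have "norm (riemann_sum \<Xi> (r1 @ [y]) - \<Xi> s y) \<le> sewing_const * (y - s) powr \<theta>"
    using 3 r1 py by (intro sewing_bound) (auto dest: partition_of_le)
  also have "(y - s) powr \<theta> = (y - s) powr (\<theta> - 1) * (y - s)"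
    using \<open>s < y\<close> powr_add[of "y - s" "\<theta> - 1" 1] by simp
  also have "sewing_const * ((y - s) powr (\<theta> - 1) * (y - s)) \<le> sewing_const * (\<delta> powr (\<theta> - 1) * (y - s))"
    using \<open>s < y\<close> \<open>y - s < \<delta>\<close> \<theta>
    by (intro mult_left_mono mult_right_mono powr_mono2 sewing_const_nonneg) auto
  finally have "norm (riemann_sum \<Xi> (r1 @ [y]) - \<Xi> s y) \<le> sewing_const * \<delta> powr (\<theta> - 1) * (y - s)"
    by (simp add: mult_ac)
  note norm_triangle_mono[OF this IH]
  moreover have "riemann_sum \<Xi> r - riemann_sum \<Xi> (x # y # p) =
      (riemann_sum \<Xi> (r1 @ [y]) - \<Xi> s y) + (riemann_sum \<Xi> (y # r2) - riemann_sum \<Xi> (y # p))"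
    using riemann_sum_append[of \<Xi> r1 y r2] by (simp add: r x)
  ultimately have "norm (riemann_sum \<Xi> r - riemann_sum \<Xi> (x # y # p)) \<le>
      sewing_const * \<delta> powr (\<theta> - 1) * (y - s) + sewing_const * \<delta> powr (\<theta> - 1) * (t - y)"
    by (simp only:)
  then show ?case by (simp add: algebra_simps)
qed

text \<open>Both sums are compared with the one over a common refinement, whence the factor
  2.\<close>

lemma riemann_sum_cauchy:
  assumes "0 \<le> s" and "t \<le> T" and "0 < \<delta>"
    and "partition_of s t p" and "mesh_below \<delta> p" and "partition_of s t q" and "mesh_below \<delta> q"
  shows "norm (riemann_sum \<Xi> p - riemann_sum \<Xi> q) \<le> 2 * (sewing_const * \<delta> powr (\<theta> - 1) * (t - s))"
proof -
  obtain r where r: "partition_of s t r" "set p \<subseteq> set r" "set q \<subseteq> set r"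
    using partition_of_common_refinement assms by meson
  show ?thesis
    using norm_triangle_ineq4[of "riemann_sum \<Xi> r - riemann_sum \<Xi> q" "riemann_sum \<Xi> r - riemann_sum \<Xi> p"]
      riemann_sum_refinement[OF assms(1-5) r(1,2)] riemann_sum_refinement[OF assms(1-3,6,7) r(1,3)]
    by simp
qed

text \<open>Since \<theta> > 1, the bound of \<open>riemann_sum_cauchy\<close> tends to 0 with
  \<delta>. Completeness gives a limit along one sequence of partitions, and the same bound
  transfers it to the whole filter.\<close>

lemma riemann_sum_convergent:
  assumes "0 \<le> s" and "s \<le> t" and "t \<le> T"
  shows "\<exists>J. (riemann_sum \<Xi> \<longlongrightarrow> J) (mesh_to_zero s t)"
proof -
  let ?e = "\<lambda>\<delta>. 2 * (sewing_const * \<delta> powr (\<theta> - 1) * (t - s))"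
  have "((\<lambda>\<delta>. \<delta> powr (\<theta> - 1)) \<longlongrightarrow> 0 powr (\<theta> - 1)) (at_right 0)"
    using \<theta> tendsto_powr'[OF tendsto_ident_at[of 0 "{0<..}"] tendsto_const]
    by (auto simp: eventually_at_filter)
  then have "((\<lambda>\<delta>. 2 * sewing_const * (t - s) * \<delta> powr (\<theta> - 1)) \<longlongrightarrow> 0) (at_right 0)"
    by (intro tendsto_mult_right_zero) simp
  moreover have "?e = (\<lambda>\<delta>. 2 * sewing_const * (t - s) * \<delta> powr (\<theta> - 1))"
    by (simp add: fun_eq_iff)
  ultimately have lim: "(?e \<longlongrightarrow> 0) (at_right 0)" by (simp only:)
  have small: "\<exists>\<delta>>0. ?e \<delta> < e" if "0 < e" for e
  proof -
    have "\<forall>\<^sub>F \<delta> in at_right 0. 0 < \<delta> \<and> ?e \<delta> < e"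
      using order_tendstoD(2)[OF lim that] eventually_at_right_less by (rule eventually_conj[rotated])
    then show ?thesis by (rule eventually_happens'[OF trivial_limit_at_right_real])
  qed
  have "\<exists>p. partition_of s t p \<and> mesh_below (inverse (Suc n)) p" for n
    using assms by (intro partition_of_exists) auto
  then obtain q where q: "\<And>n. partition_of s t (q n)" "\<And>n. mesh_below (inverse (Suc n)) (q n)"
    by metis
  have q_mesh: "\<exists>N. \<forall>n\<ge>N. mesh_below \<delta> (q n)" if "0 < \<delta>" for \<delta>
  proof -
    obtain N where N: "inverse (Suc N) < \<delta>" using reals_Archimedean \<open>0 < \<delta>\<close> by blast
    have "mesh_below \<delta> (q n)" if "N \<le> n" for n
    proof -
      have "inverse (real (Suc n)) \<le> inverse (Suc N)" using that by (intro le_imp_inverse_le) auto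
      with N have "inverse (real (Suc n)) \<le> \<delta>" by linarith
      with q(2)[of n] show ?thesis unfolding mesh_below_def by (meson order.strict_trans2)
    qed
    then show ?thesis by blast
  qed
  have "Cauchy (\<lambda>n. riemann_sum \<Xi> (q n))"
  proof (rule CauchyI)
    fix e :: real assume "0 < e"
    with small obtain \<delta> where \<delta>: "0 < \<delta>" "?e \<delta> < e" by blast
    with q_mesh obtain N where "\<forall>n\<ge>N. mesh_below \<delta> (q n)" by blast
    then have "norm (riemann_sum \<Xi> (q m) - riemann_sum \<Xi> (q n)) < e" if "N \<le> m" "N \<le> n" for m n
      using riemann_sum_cauchy[OF assms(1,3) \<delta>(1) q(1) _ q(1)] \<delta>(2) that
      by (meson order.strict_trans1)
    then show "\<exists>N. \<forall>m\<ge>N. \<forall>n\<ge>N. norm (riemann_sum \<Xi> (q m) - riemann_sum \<Xi> (q n)) < e"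
      by blast
  qed
  then obtain J where J: "(\<lambda>n. riemann_sum \<Xi> (q n)) \<longlonglongrightarrow> J"
    by (auto simp: Cauchy_convergent_iff convergent_def)
  have "(riemann_sum \<Xi> \<longlongrightarrow> J) (mesh_to_zero s t)"
  proof (rule tendstoI)
    fix e :: real assume "0 < e"
    with small obtain \<delta> where \<delta>: "0 < \<delta>" "?e \<delta> < e" by blast
    with q_mesh obtain N where N: "\<forall>n\<ge>N. mesh_below \<delta> (q n)" by blast
    have "dist (riemann_sum \<Xi> p) J < e" if p: "partition_of s t p" "mesh_below \<delta> p" for p
    proof -
      \<comment> \<open>With p fixed, n tends to infinity in the Cauchy bound.\<close>
      have "(\<lambda>n. norm (riemann_sum \<Xi> p - riemann_sum \<Xi> (q n))) \<longlonglongrightarrow> norm (riemann_sum \<Xi> p - J)"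
        by (intro tendsto_intros J)
      moreover have "\<exists>N. \<forall>n\<ge>N. norm (riemann_sum \<Xi> p - riemann_sum \<Xi> (q n)) \<le> ?e \<delta>"
        using N riemann_sum_cauchy[OF assms(1,3) \<delta>(1) p q(1)] by blast
      ultimately have "norm (riemann_sum \<Xi> p - J) \<le> ?e \<delta>" by (rule LIMSEQ_le_const2)
      with \<delta> show ?thesis by (simp add: dist_norm)
    qed
    with \<delta>(1) show "\<forall>\<^sub>F p in mesh_to_zero s t. dist (riemann_sum \<Xi> p) J < e"
      unfolding eventually_mesh_to_zero by blast
  qed
  then show ?thesis ..
qed

lemma riemann_sum_limit_bound:
  assumes "0 \<le> s" and "s \<le> t" and "t \<le> T" and J: "(riemann_sum \<Xi> \<longlongrightarrow> J) (mesh_to_zero s t)"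
  shows "norm (J - \<Xi> s t) \<le> sewing_const * (t - s) powr \<theta>"
proof (rule tendsto_upperbound)
  show "((\<lambda>p. norm (riemann_sum \<Xi> p - \<Xi> s t)) \<longlongrightarrow> norm (J - \<Xi> s t)) (mesh_to_zero s t)"
    by (intro tendsto_intros J)
  show "\<forall>\<^sub>F p in mesh_to_zero s t. norm (riemann_sum \<Xi> p - \<Xi> s t) \<le> sewing_const * (t - s) powr \<theta>"
    \<comment> \<open>The sewing bound holds for every partition, so the mesh threshold 1 is an
      arbitrary choice.\<close>
    unfolding eventually_mesh_to_zero using sewing_bound[OF assms(1,3)] zero_less_one by blast
qed (use mesh_to_zero_neq_bot assms in auto)

end

text \<open>Fine partitions of [s, u] and [u, t] concatenate to a fine partition of [s, t] whose
  Riemann sum is the sum of the two.\<close>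

lemma riemann_sum_limit_additive:
  assumes "s \<le> u" and "u \<le> t"
    and I: "(riemann_sum \<Xi> \<longlongrightarrow> I) (mesh_to_zero s u)"
    and J: "(riemann_sum \<Xi> \<longlongrightarrow> J) (mesh_to_zero u t)"
    and K: "(riemann_sum \<Xi> \<longlongrightarrow> K) (mesh_to_zero s t)"
  shows "K = I + J"
proof -
  have "dist K (I + J) \<le> e" if "0 < e" for e
  proof -
    obtain d1 d2 d3 where d: "0 < d1" "0 < d2" "0 < d3"
      and d1: "\<And>p. partition_of s u p \<Longrightarrow> mesh_below d1 p \<Longrightarrow> dist (riemann_sum \<Xi> p) I < e / 3"
      and d2: "\<And>p. partition_of u t p \<Longrightarrow> mesh_below d2 p \<Longrightarrow> dist (riemann_sum \<Xi> p) J < e / 3"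
      and d3: "\<And>p. partition_of s t p \<Longrightarrow> mesh_below d3 p \<Longrightarrow> dist (riemann_sum \<Xi> p) K < e / 3"
      using tendstoD[OF I, of "e/3"] tendstoD[OF J, of "e/3"] tendstoD[OF K, of "e/3"] \<open>0 < e\<close>
      unfolding eventually_mesh_to_zero by auto
    define d where "d = min d1 (min d2 d3)"
    have "0 < d" using d by (simp add: d_def)
    obtain p q where p: "partition_of s u p" "mesh_below d p" and q: "partition_of u t q" "mesh_below d q"
      using partition_of_exists assms(1,2) \<open>0 < d\<close> by meson
    have mono: "mesh_below d1 r" "mesh_below d2 r" "mesh_below d3 r" if "mesh_below d r" for r
      using that unfolding mesh_below_def d_def by auto
    obtain p' where p': "p = p' @ [u]"
      using p(1) by (cases p rule: rev_cases) (auto simp: partition_of_def)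
    obtain q' where q': "q = u # q'"
      using q(1) by (cases q) (auto simp: partition_of_def)
    have "dist (riemann_sum \<Xi> (p' @ u # q')) K < e / 3"
      using p(1) q(1) mono[OF p(2)] mono[OF q(2)] unfolding p' q'
      by (intro d3) (simp_all add: partition_of_append[of s t] mesh_below_append[of d3 p' u q'])
    moreover have "dist (riemann_sum \<Xi> p) I < e / 3"
      using p mono by (intro d1)
    moreover have "dist (riemann_sum \<Xi> q) J < e / 3"
      using q mono by (intro d2)
    moreover have "riemann_sum \<Xi> (p' @ u # q') = riemann_sum \<Xi> p + riemann_sum \<Xi> q"
      using riemann_sum_append[of \<Xi> p' u q'] by (simp add: p' q')
    ultimately show ?thesis
      using dist_triangle_add[of "riemann_sum \<Xi> p" "riemann_sum \<Xi> q" I J]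
        dist_triangle3[of K "I + J" "riemann_sum \<Xi> (p' @ u # q')"] by simp
  qed
  then show ?thesis using field_le_epsilon[of "dist K (I + J)" 0] by simp
qed

section \<open>Integration of controlled paths\<close>

lemma holder_boundedI:
  assumes "\<And>s t. 0 \<le> s \<Longrightarrow> s < t \<Longrightarrow> t \<le> T \<Longrightarrow> norm (F s t) \<le> C * (t - s) powr \<beta>"
  shows "holder_bounded \<beta> T F"
  unfolding holder_bounded_def bdd_above_def
  using assms by (auto intro!: exI[of _ C] simp: divide_le_eq)

text \<open>The supremum concerns s < t only; vanishing on the diagonal extends the estimate to s =
  t, so that later arguments may use degenerate intervals. The maximum with 0 makes the constant
  nonnegative.\<close>

lemma holder_boundedE:
  assumes "holder_bounded \<beta> T F" and "\<And>s. 0 \<le> s \<Longrightarrow> s \<le> T \<Longrightarrow> F s s = 0"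
  obtains C where "0 \<le> C"
    and "\<And>s t. 0 \<le> s \<Longrightarrow> s \<le> t \<Longrightarrow> t \<le> T \<Longrightarrow> norm (F s t) \<le> C * (t - s) powr \<beta>"
proof -
  obtain C where C: "\<And>s t. 0 \<le> s \<Longrightarrow> s < t \<Longrightarrow> t \<le> T \<Longrightarrow> norm (F s t) / (t - s) powr \<beta> \<le> C"
    using assms(1) unfolding holder_bounded_def bdd_above_def by blast
  show thesis
  proof (rule that[of "max C 0"])
    fix s t assume st: "0 \<le> s" "s \<le> t" "t \<le> T"
    show "norm (F s t) \<le> max C 0 * (t - s) powr \<beta>"
    proof (cases "s = t")
      case False
      with st have "norm (F s t) \<le> C * (t - s) powr \<beta>"
        using C[of s t] by (simp add: divide_le_eq)
      also have "\<dots> \<le> max C 0 * (t - s) powr \<beta>" by (intro mult_right_mono) auto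
      finally show ?thesis .
    qed (use st assms(2) in auto)
  qed simp
qed

lemma norm_blinfun_apply_le:
  assumes "norm f \<le> p" and "norm x \<le> q"
  shows "norm (blinfun_apply f x) \<le> p * q"
  using norm_blinfun[of f x] mult_mono[OF assms] norm_ge_zero[of f] norm_ge_zero[of x] assms(1)
  by linarith

text \<open>Both algebraic relations are read at s = u = t.\<close>

lemma rough_path_refl:
  assumes "rough_path tens \<alpha> T X XX" and "bilinear tens" and "0 \<le> s" and "s \<le> T"
  shows "X s s = 0" and "XX s s = 0"
proof -
  have "X s s = X s s + X s s" and XX: "XX s s = XX s s + XX s s + tens (X s s) (X s s)"
    using assms unfolding rough_path_def by blast+
  then show X: "X s s = 0" by simp
  show "XX s s = 0" using XX bilinear_lzero[OF assms(2)] by (simp add: X)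
qed

text \<open>Collects every estimate under one constant. Y' is bounded through its value at 0 and its
  Hoelder bound; then Y is \<alpha>-Hoelder, because Y' X is of order \<alpha> and the remainder of
  order 2 \<alpha> costs a factor T^\<alpha>; finally Y is bounded through Y 0.\<close>

lemma controlled_path_bounds:
  assumes Y: "(Y, Y') \<in> controlled_paths \<alpha> T X" and "0 < \<alpha>" and "0 < T"
    and X: "\<And>s t. 0 \<le> s \<Longrightarrow> s \<le> t \<Longrightarrow> t \<le> T \<Longrightarrow> norm (X s t) \<le> CX * (t - s) powr \<alpha>"
    and X0: "\<And>s. 0 \<le> s \<Longrightarrow> s \<le> T \<Longrightarrow> X s s = 0"
  obtains K where "0 \<le> K"
    and "\<And>s t. 0 \<le> s \<Longrightarrow> s \<le> t \<Longrightarrow> t \<le> T \<Longrightarrow> norm (Y t - Y s - Y' s (X s t)) \<le> K * (t - s) powr (2 * \<alpha>)"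
    and "\<And>s t. 0 \<le> s \<Longrightarrow> s \<le> t \<Longrightarrow> t \<le> T \<Longrightarrow> norm (Y' t - Y' s) \<le> K * (t - s) powr \<alpha>"
    and "\<And>s t. 0 \<le> s \<Longrightarrow> s \<le> t \<Longrightarrow> t \<le> T \<Longrightarrow> norm (Y t - Y s) \<le> K * (t - s) powr \<alpha>"
    and "\<And>t. 0 \<le> t \<Longrightarrow> t \<le> T \<Longrightarrow> norm (Y t) \<le> K"
    and "\<And>t. 0 \<le> t \<Longrightarrow> t \<le> T \<Longrightarrow> norm (Y' t) \<le> K"
proof -
  have hY: "holder_bounded (2 * \<alpha>) T (\<lambda>s t. Y t - Y s - Y' s (X s t))"
    and hY': "holder_bounded \<alpha> T (\<lambda>s t. Y' t - Y' s)"
    using Y by (auto simp: controlled_paths_def)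
  obtain R where "0 \<le> R" and R: "\<And>s t. 0 \<le> s \<Longrightarrow> s \<le> t \<Longrightarrow> t \<le> T \<Longrightarrow>
      norm (Y t - Y s - Y' s (X s t)) \<le> R * (t - s) powr (2 * \<alpha>)"
    by (rule holder_boundedE[OF hY]) (auto simp: X0)
  obtain R' where "0 \<le> R'" and R': "\<And>s t. 0 \<le> s \<Longrightarrow> s \<le> t \<Longrightarrow> t \<le> T \<Longrightarrow>
      norm (Y' t - Y' s) \<le> R' * (t - s) powr \<alpha>"
    by (rule holder_boundedE[OF hY']) auto
  have T: "r powr \<alpha> \<le> T powr \<alpha>" if "0 \<le> r" "r \<le> T" for r
    using that \<open>0 < \<alpha>\<close> by (intro powr_mono2) auto
  define M' where "M' = norm (Y' 0) + R' * T powr \<alpha>"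
  have M': "norm (Y' t) \<le> M'" if t: "0 \<le> t" "t \<le> T" for t
  proof -
    have "norm (Y' t - Y' 0) \<le> R' * T powr \<alpha>"
      using R'[of 0 t] mult_left_mono[OF T[OF t] \<open>0 \<le> R'\<close>] t by simp
    then show ?thesis using norm_triangle_sub[of "Y' t" "Y' 0"] by (simp add: M'_def)
  qed
  define H where "H = M' * CX + R * T powr \<alpha>"
  have H: "norm (Y t - Y s) \<le> H * (t - s) powr \<alpha>" if st: "0 \<le> s" "s \<le> t" "t \<le> T" for s t
  proof -
    have "norm (Y' s (X s t)) \<le> M' * (CX * (t - s) powr \<alpha>)"
      using st by (intro norm_blinfun_apply_le M' X) auto
    moreover have "norm (Y t - Y s - Y' s (X s t)) \<le> R * T powr \<alpha> * (t - s) powr \<alpha>"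
    proof -
      have "R * (t - s) powr (2 * \<alpha>) = R * (t - s) powr \<alpha> * (t - s) powr \<alpha>"
        by (simp add: powr_add[symmetric])
      also have "\<dots> \<le> R * T powr \<alpha> * (t - s) powr \<alpha>"
        using st \<open>0 \<le> R\<close> by (intro mult_right_mono mult_left_mono T) auto
      finally show ?thesis using R[OF st] by simp
    qed
    ultimately show ?thesis
      using norm_triangle_sub[of "Y t - Y s" "Y' s (X s t)"] by (simp add: H_def algebra_simps)
  qed
  \<comment> \<open>The sign of H is not known, as none is assumed for CX; the absolute value keeps
    the comparison of powers monotone.\<close>
  define M where "M = norm (Y 0) + \<bar>H\<bar> * T powr \<alpha>"
  have M: "norm (Y t) \<le> M" if t: "0 \<le> t" "t \<le> T" for t
  proof -
    have "norm (Y t - Y 0) \<le> \<bar>H\<bar> * t powr \<alpha>"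
      using H[of 0 t] mult_right_mono[OF abs_ge_self[of H], of "t powr \<alpha>"] t by simp
    also have "\<dots> \<le> \<bar>H\<bar> * T powr \<alpha>" using T t by (intro mult_left_mono) auto
    finally show ?thesis using norm_triangle_sub[of "Y t" "Y 0"] by (simp add: M_def)
  qed
  define K where "K = Max {R, R', H, M, M'}"
  have K: "R \<le> K" "R' \<le> K" "H \<le> K" "M \<le> K" "M' \<le> K" by (auto simp: K_def)
  have le: "x \<le> K * r powr b" if "x \<le> c * r powr b" "c \<le> K" for x c r b
    using that mult_right_mono[of c K "r powr b"] by simp
  show thesis
    using K \<open>0 \<le> R\<close>
    by (intro that[of K] le[OF R] le[OF R'] le[OF H] order.trans[OF M] order.trans[OF M']) auto
qed

section \<open>The indefinite rough integral as a controlled path\<close>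

theorem proposition3p1:
  fixes \<alpha> T :: real
    and tens :: "'v::banach \<Rightarrow> 'v \<Rightarrow> 't::banach"
    and X :: "real \<Rightarrow> real \<Rightarrow> 'v" and XX :: "real \<Rightarrow> real \<Rightarrow> 't"
    and Y :: "real \<Rightarrow> ('w::banach \<Rightarrow>\<^sub>L 'u::banach)" and Y' :: "real \<Rightarrow> 'v \<Rightarrow>\<^sub>L ('w \<Rightarrow>\<^sub>L 'u)"
    and Z :: "real \<Rightarrow> 'w" and Z' :: "real \<Rightarrow> 'v \<Rightarrow>\<^sub>L 'w"
  assumes "1/3 < \<alpha>" and "\<alpha> \<le> 1/2" and "0 < T"
    and "projective_tensor tens"
    and "rough_path tens \<alpha> T X XX"
    and "(Y, Y') \<in> controlled_paths \<alpha> T X"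
    and "(Z, Z') \<in> controlled_paths \<alpha> T X"
  shows "(\<lambda>t. rough_integral tens XX (Y, Y') (Z, Z') 0 t, \<lambda>t. Y t o\<^sub>L Z' t)
           \<in> controlled_paths \<alpha> T X"
proof -
  note tens = \<open>projective_tensor tens\<close>
  have \<alpha>: "0 < \<alpha>" "1 < 3 * \<alpha>" using \<open>1/3 < \<alpha>\<close> by auto
  have "bilinear tens" using tens by (simp add: projective_tensor_def)
  note refl = rough_path_refl[OF \<open>rough_path tens \<alpha> T X XX\<close> this]
  have hX: "holder_bounded \<alpha> T X" and hXX: "holder_bounded (2 * \<alpha>) T XX"
    and chen: "\<And>s u t. 0 \<le> s \<Longrightarrow> s \<le> u \<Longrightarrow> u \<le> t \<Longrightarrow> t \<le> T \<Longrightarrow>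
      XX s t = XX s u + XX u t + tens (X s u) (X u t)"
    using \<open>rough_path tens \<alpha> T X XX\<close> unfolding rough_path_def by blast+
  obtain CX where X: "0 \<le> CX"
      "\<And>s t. 0 \<le> s \<Longrightarrow> s \<le> t \<Longrightarrow> t \<le> T \<Longrightarrow> norm (X s t) \<le> CX * (t - s) powr \<alpha>"
    using holder_boundedE[OF hX refl(1)] by blast
  obtain CXX where XX: "0 \<le> CXX"
      "\<And>s t. 0 \<le> s \<Longrightarrow> s \<le> t \<Longrightarrow> t \<le> T \<Longrightarrow> norm (XX s t) \<le> CXX * (t - s) powr (2 * \<alpha>)"
    using holder_boundedE[OF hXX refl(2)] by blast
  obtain KY where Y: "0 \<le> KY"
    "\<And>s t. 0 \<le> s \<Longrightarrow> s \<le> t \<Longrightarrow> t \<le> T \<Longrightarrow> norm (Y t - Y s - Y' s (X s t)) \<le> KY * (t - s) powr (2 * \<alpha>)"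
    "\<And>s t. 0 \<le> s \<Longrightarrow> s \<le> t \<Longrightarrow> t \<le> T \<Longrightarrow> norm (Y' t - Y' s) \<le> KY * (t - s) powr \<alpha>"
    "\<And>s t. 0 \<le> s \<Longrightarrow> s \<le> t \<Longrightarrow> t \<le> T \<Longrightarrow> norm (Y t - Y s) \<le> KY * (t - s) powr \<alpha>"
    "\<And>t. 0 \<le> t \<Longrightarrow> t \<le> T \<Longrightarrow> norm (Y t) \<le> KY"
    "\<And>t. 0 \<le> t \<Longrightarrow> t \<le> T \<Longrightarrow> norm (Y' t) \<le> KY"
    using controlled_path_bounds[OF \<open>(Y, Y') \<in> _\<close> \<alpha>(1) \<open>0 < T\<close> X(2) refl(1)] by blast
  obtain KZ where Z: "0 \<le> KZ"
    "\<And>s t. 0 \<le> s \<Longrightarrow> s \<le> t \<Longrightarrow> t \<le> T \<Longrightarrow> norm (Z t - Z s - Z' s (X s t)) \<le> KZ * (t - s) powr (2 * \<alpha>)"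
    "\<And>s t. 0 \<le> s \<Longrightarrow> s \<le> t \<Longrightarrow> t \<le> T \<Longrightarrow> norm (Z' t - Z' s) \<le> KZ * (t - s) powr \<alpha>"
    "\<And>s t. 0 \<le> s \<Longrightarrow> s \<le> t \<Longrightarrow> t \<le> T \<Longrightarrow> norm (Z t - Z s) \<le> KZ * (t - s) powr \<alpha>"
    "\<And>t. 0 \<le> t \<Longrightarrow> t \<le> T \<Longrightarrow> norm (Z t) \<le> KZ"
    "\<And>t. 0 \<le> t \<Longrightarrow> t \<le> T \<Longrightarrow> norm (Z' t) \<le> KZ"
    using controlled_path_bounds[OF \<open>(Z, Z') \<in> _\<close> \<alpha>(1) \<open>0 < T\<close> X(2) refl(1)] by blast
  define L where "L u = tensor_extension tens (Y' u) (Z' u)" for u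
  have L_tens: "L s (tens x y) = Y' s x (Z' s y)" for s x y
    by (simp add: L_def tensor_extension_apply[OF tens])
  have L: "norm (L s) \<le> KY * KZ" if "0 \<le> s" "s \<le> T" for s
    unfolding L_def using Y Z that
    by (intro order.trans[OF norm_tensor_extension[OF tens]] mult_mono) auto
  have L_diff: "norm (L t - L s) \<le> 2 * KY * KZ * (t - s) powr \<alpha>"
    if st: "0 \<le> s" "s \<le> t" "t \<le> T" for s t
  proof -
    have "norm (tensor_extension tens (Y' t - Y' s) (Z' t)) \<le> (KY * (t - s) powr \<alpha>) * KZ"
      using Y Z st by (intro order.trans[OF norm_tensor_extension[OF tens]] mult_mono) auto
    moreover have "norm (tensor_extension tens (Y' s) (Z' t - Z' s)) \<le> KY * (KZ * (t - s) powr \<alpha>)"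
      using Y Z st by (intro order.trans[OF norm_tensor_extension[OF tens]] mult_mono) auto
    ultimately show ?thesis
      unfolding L_def tensor_extension_diff[OF tens] using norm_triangle_mono by fastforce
  qed
  define \<Xi> where "\<Xi> u v = Y u (Z v - Z u) + L u (XX u v)" for u v
  \<comment> \<open>The four summands bound, in order, the four terms of the defect of \<Xi>
    estimated below; the 2 comes from \<open>L_diff\<close>.\<close>
  define C where "C = KY * KZ + KY * CX * KZ + KY * CX * (KZ * CX) + 2 * KY * KZ * CXX"
  have "0 \<le> C" using X Y Z XX by (simp add: C_def)
  have powr3: "r powr (3 * \<alpha>) = r powr \<alpha> * r powr \<alpha> * r powr \<alpha>"
    and powr2: "r powr (2 * \<alpha>) = r powr \<alpha> * r powr \<alpha>" for r :: real
    by (simp_all add: powr_add[symmetric])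
  have almost_additive: "norm (\<Xi> s t - \<Xi> s u - \<Xi> u t) \<le> C * (t - s) powr (3 * \<alpha>)"
    if sut: "0 \<le> s" "s \<le> u" "u \<le> t" "t \<le> T" for s u t
  proof -
    \<comment> \<open>All increments over [s, u] and [u, t] are measured by a, so each term of the
      defect becomes a constant times a^3.\<close>
    define a where "a = (t - s) powr \<alpha>"
    have le1: "c * (u - s) powr \<alpha> \<le> c * a" "c * (t - u) powr \<alpha> \<le> c * a" if "0 \<le> c" for c
      using sut \<alpha> that unfolding a_def by (auto intro!: mult_left_mono powr_mono2)
    have le2: "c * (u - s) powr (2 * \<alpha>) \<le> c * (a * a)" "c * (t - u) powr (2 * \<alpha>) \<le> c * (a * a)"
      if "0 \<le> c" for c
      using sut \<alpha> that unfolding a_def powr2 by (auto intro!: mult_left_mono mult_mono powr_mono2)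
    have "norm ((Y u - Y s - Y' s (X s u)) (Z t - Z u)) \<le> (KY * (a * a)) * (KZ * a)"
      using sut Y Z by (intro norm_blinfun_apply_le order.trans[OF Y(2)] order.trans[OF Z(4)] le1 le2) auto
    moreover have "norm (Y' s (X s u) (Z t - Z u - Z' u (X u t))) \<le> (KY * (CX * a)) * (KZ * (a * a))"
      using sut X Y Z
      by (intro norm_blinfun_apply_le Y(6) order.trans[OF X(2)] order.trans[OF Z(2)] le1 le2) auto
    moreover have "norm (Y' s (X s u) ((Z' u - Z' s) (X u t))) \<le> (KY * (CX * a)) * (KZ * a * (CX * a))"
      using sut X Y Z
      by (intro norm_blinfun_apply_le Y(6) order.trans[OF X(2)] order.trans[OF Z(3)] le1 le2) auto
    moreover have "norm ((L u - L s) (XX u t)) \<le> (2 * KY * KZ * a) * (CXX * (a * a))"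
      using sut X Y Z XX
      by (intro norm_blinfun_apply_le order.trans[OF L_diff] order.trans[OF XX(2)] le1 le2) auto
    \<comment> \<open>Chen's relation contributes \<open>Y' s (X s u) (Z' s (X u t))\<close>, which
      cancels the leading part of \<open>Y' s (X s u) (Z t - Z u)\<close> and leaves the remainder
      of Z and the increment of Z'.\<close>
    moreover have "\<Xi> s t - \<Xi> s u - \<Xi> u t = - ((Y u - Y s - Y' s (X s u)) (Z t - Z u)
        + Y' s (X s u) (Z t - Z u - Z' u (X u t)) + Y' s (X s u) ((Z' u - Z' s) (X u t))
        + (L u - L s) (XX u t))"
      by (simp add: \<Xi>_def chen[OF sut] blinfun.bilinear_simps L_tens algebra_simps)
    ultimately have "norm (\<Xi> s t - \<Xi> s u - \<Xi> u t) \<le> (KY * (a * a)) * (KZ * a)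
        + (KY * (CX * a)) * (KZ * (a * a)) + (KY * (CX * a)) * (KZ * a * (CX * a))
        + (2 * KY * KZ * a) * (CXX * (a * a))"
      by (simp only: norm_minus_cancel) (intro norm_triangle_mono)
    also have "\<dots> = C * (t - s) powr (3 * \<alpha>)"
      unfolding C_def powr3 a_def by (simp add: algebra_simps)
    finally show ?thesis .
  qed
  define J where "J s t = rough_integral tens XX (Y, Y') (Z, Z') s t" for s t
  have J: "(riemann_sum \<Xi> \<longlongrightarrow> J s t) (mesh_to_zero s t)" if st: "0 \<le> s" "s \<le> t" "t \<le> T" for s t
  proof -
    obtain I where I: "(riemann_sum \<Xi> \<longlongrightarrow> I) (mesh_to_zero s t)"
      using riemann_sum_convergent[OF \<alpha>(2) \<open>0 \<le> C\<close> almost_additive st] by blast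
    \<comment> \<open>\<open>Lim\<close> picks out the limit I because \<open>mesh_to_zero\<close>
      is a proper filter for s \<le> t.\<close>
    have "J s t = Lim (mesh_to_zero s t) (riemann_sum \<Xi>)"
      by (simp add: J_def rough_integral_def riemann_sum_def[abs_def] \<Xi>_def L_def Let_def)
    also have "\<dots> = I" using mesh_to_zero_neq_bot st I by (intro tendsto_Lim) auto
    finally show ?thesis using I by simp
  qed
  define S where "S = sewing_const (3 * \<alpha>) C"
  have J_bound: "norm (J s t - \<Xi> s t) \<le> S * (t - s) powr (3 * \<alpha>)"
    if st: "0 \<le> s" "s \<le> t" "t \<le> T" for s t
    unfolding S_def
    by (rule riemann_sum_limit_bound[OF \<alpha>(2) \<open>0 \<le> C\<close> almost_additive st J[OF st]])
  have "0 \<le> S" unfolding S_def using sewing_const_nonneg[OF \<alpha>(2) \<open>0 \<le> C\<close> almost_additive] .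
  have "holder_bounded (2 * \<alpha>) T (\<lambda>s t. J 0 t - J 0 s - (Y s o\<^sub>L Z' s) (X s t))"
  proof (rule holder_boundedI)
    fix s t assume "0 \<le> s" "s < t" "t \<le> T"
    then have st: "0 \<le> s" "s \<le> t" "t \<le> T" by auto
    \<comment> \<open>One factor (t - s)^\<alpha> is traded for T^\<alpha>, lowering the exponent
      from 3 \<alpha> to 2 \<alpha>.\<close>
    have "norm (J s t - \<Xi> s t) \<le> S * T powr \<alpha> * (t - s) powr (2 * \<alpha>)"
    proof -
      have "(t - s) powr \<alpha> \<le> T powr \<alpha>" using st \<alpha> by (intro powr_mono2) auto
      then have "S * ((t - s) powr \<alpha> * (t - s) powr (2 * \<alpha>)) \<le> S * (T powr \<alpha> * (t - s) powr (2 * \<alpha>))"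
        using \<open>0 \<le> S\<close> by (intro mult_left_mono mult_right_mono) auto
      then show ?thesis using J_bound[OF st] unfolding powr3 powr2 by (simp add: mult_ac)
    qed
    moreover have "norm (Y s (Z t - Z s - Z' s (X s t))) \<le> KY * (KZ * (t - s) powr (2 * \<alpha>))"
      using st Y Z by (intro norm_blinfun_apply_le) auto
    moreover have "norm (L s (XX s t)) \<le> KY * KZ * (CXX * (t - s) powr (2 * \<alpha>))"
      using st L XX by (intro norm_blinfun_apply_le) auto
    moreover have "J 0 t = J 0 s + J s t"
      using st by (intro riemann_sum_limit_additive[OF st(1,2) J J J]) auto
    \<comment> \<open>By additivity the increment is J s t; subtracting the Gubinelli term from
      \<Xi> s t leaves Y applied to the remainder of Z, plus the second-order term.\<close>
    then have "J 0 t - J 0 s - (Y s o\<^sub>L Z' s) (X s t)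
        = (J s t - \<Xi> s t) + Y s (Z t - Z s - Z' s (X s t)) + L s (XX s t)"
      by (simp add: \<Xi>_def blinfun.bilinear_simps)
    ultimately have "norm (J 0 t - J 0 s - (Y s o\<^sub>L Z' s) (X s t)) \<le> S * T powr \<alpha> * (t - s) powr (2 * \<alpha>)
        + KY * (KZ * (t - s) powr (2 * \<alpha>)) + KY * KZ * (CXX * (t - s) powr (2 * \<alpha>))"
      by (simp only:) (intro norm_triangle_mono)
    then show "norm (J 0 t - J 0 s - (Y s o\<^sub>L Z' s) (X s t))
        \<le> (S * T powr \<alpha> + KY * KZ + KY * KZ * CXX) * (t - s) powr (2 * \<alpha>)"
      by (simp add: algebra_simps)
  qed
  moreover have "holder_bounded \<alpha> T (\<lambda>s t. (Y t o\<^sub>L Z' t) - (Y s o\<^sub>L Z' s))"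
  proof (rule holder_boundedI)
    fix s t assume "0 \<le> s" "s < t" "t \<le> T"
    then have st: "0 \<le> s" "s \<le> t" "t \<le> T" by auto
    have "norm ((Y t - Y s) o\<^sub>L Z' t) \<le> (KY * (t - s) powr \<alpha>) * KZ"
      using st Y Z by (intro order.trans[OF norm_blinfun_compose] mult_mono) auto
    moreover have "norm (Y s o\<^sub>L (Z' t - Z' s)) \<le> KY * (KZ * (t - s) powr \<alpha>)"
      using st Y Z by (intro order.trans[OF norm_blinfun_compose] mult_mono) auto
    \<comment> \<open>The product rule again: each term pairs an increment of order \<alpha> with a
      bounded factor.\<close>
    moreover have "(Y t o\<^sub>L Z' t) - (Y s o\<^sub>L Z' s) = ((Y t - Y s) o\<^sub>L Z' t) + (Y s o\<^sub>L (Z' t - Z' s))"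
      by (intro blinfun_eqI) (simp add: blinfun.bilinear_simps)
    ultimately have "norm ((Y t o\<^sub>L Z' t) - (Y s o\<^sub>L Z' s)) \<le> (KY * (t - s) powr \<alpha>) * KZ + KY * (KZ * (t - s) powr \<alpha>)"
      by (simp only:) (intro norm_triangle_mono)
    then show "norm ((Y t o\<^sub>L Z' t) - (Y s o\<^sub>L Z' s)) \<le> (2 * KY * KZ) * (t - s) powr \<alpha>"
      by (simp add: algebra_simps)
  qed
  ultimately show ?thesis by (simp add: controlled_paths_def J_def)
qed

end
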